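(* Let $L>0$, let $f:\mathbb{R}^n\to\mathbb{R}$ be a convex $L$-smooth function with a minimizer $x_\star$, let $k\ge 0$ be an integer and let $N=2^k-1$. For any $x_0\in\mathbb{R}^n$, let $x_1,\dots,x_N$ be generated by gradient descent $x_{i+1}=x_i-\frac{h_i}{L}\nabla f(x_i)$, $i=0,\dots,N-1$, with stepsizes $h=(h_0,\dots,h_{N-1})=\mathfrak{h}^{(k)}_{\mathrm{left}}$. Then $$\frac12\|\nabla f(x_N)\|^2\le \frac{L\,(f(x_0)-f(x_\star))}{r_k}\simeq \frac{1}{(\varrho-1)(1+\varrho^{-1/2})}\cdot\frac{L\,(f(x_0)-f(x_\star))}{N^{\log_2\varrho}},$$ where $\simeq$ denotes equality up to lower-order terms as $k\to\infty$, i.e. with $N=2^k-1$, $\lim_{k\to\infty} r_k/N^{\log_2\varrho}=(\varrho-1)(1+\varrho^{-1/2})$.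
   Context: $L$-smooth means differentiable with $L$-Lipschitz gradient (Euclidean norm). Let $\varrho=1+\sqrt2$ and $\beta_k=1+\varrho^{k-1}$ for $k\ge0$. All finite sequences are indexed starting from $0$, and $[\cdot,\cdot,\cdot]$ denotes concatenation. The silver stepsize schedules $\pi^{(k)}\in\mathbb{R}^{2^k-1}$, $k\ge1$, are defined by $\pi^{(1)}=[\sqrt2]$ and $\pi^{(k+1)}=[\pi^{(k)},\beta_k,\pi^{(k)}]$. The sequences $\mathfrak{h}^{(k)}_{\mathrm{right}}\in\mathbb{R}^{2^k-1}$, $k\ge1$, are defined by $\mathfrak{h}^{(1)}_{\mathrm{right}}=[3/2]$ and $\mathfrak{h}^{(k+1)}_{\mathrm{right}}=[\pi^{(k)},\alpha_k,\mathfrak{h}^{(k)}_{\mathrm{right}}]$, where $\alpha_k$ is the unique real number with $\alpha_k\ge1$ such that $$1+2\sum_{i=0}^{2^{k+1}-2}(\mathfrak{h}^{(k+1)}_{\mathrm{right}})_i=\prod_{i=0}^{2^{k+1}-2}\big((\mathfrak{h}^{(k+1)}_{\mathrm{right}})_i-1\big)^{-2}.$$ The sequence $\mathfrak{h}^{(k)}_{\mathrm{left}}$ is $\mathfrak{h}^{(k)}_{\mathrm{right}}$ in reverse order, i.e. $\mathfrak{h}^{(1)}_{\mathrm{left}}=[3/2]$ and $\mathfrak{h}^{(k+1)}_{\mathrm{left}}=[\mathfrak{h}^{(k)}_{\mathrm{left}},\alpha_k,\pi^{(k)}]$. Define $r_k=1+2\sum_{i=0}^{2^k-2}(\mathfrak{h}^{(k)}_{\mathrm{right}})_i=\prod_{i=0}^{2^k-2}\big((\mathfrak{h}^{(k)}_{\mathrm{right}})_i-1\big)^{-2}$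 (for instance $r_1=4$). For $k=0$ the sequences $\mathfrak{h}^{(0)}_{\mathrm{left}}$ and $\mathfrak{h}^{(0)}_{\mathrm{right}}$ are empty and $r_0=1$. *)

theory Defs
  imports "HOL-Analysis.Analysis"
begin

definition gradient :: "('a::euclidean_space \<Rightarrow> real) \<Rightarrow> 'a \<Rightarrow> 'a" where
  "gradient f x = (THE D. GDERIV f x :> D)"

lemma gradient_eqI:
  assumes "GDERIV f x :> D"
  shows "gradient f x = D"
  unfolding gradient_def
proof (rule the_equality)
  fix E assume "GDERIV f x :> E"
  then have "(\<lambda>h. inner h E) = (\<lambda>h. inner h D)"
    using assms unfolding gderiv_def by (rule has_derivative_unique)
  then show "E = D"
    by (metis euclidean_eqI inner_commute)
qed (rule assms)

lemma GDERIV_gradient: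
  assumes "f differentiable (at x)"
  shows "GDERIV f x :> gradient f x"
proof -
  obtain f' where f': "(f has_derivative f') (at x)"
    using assms unfolding differentiable_def by blast
  have lin: "linear f'"
    using f' by (rule has_derivative_linear)
  have "f' = (\<lambda>h. inner h (\<Sum>b\<in>Basis. f' b *\<^sub>R b))"
  proof
    fix h
    have "f' h = f' (\<Sum>b\<in>Basis. inner h b *\<^sub>R b)"
      by (simp add: euclidean_representation)
    also have "\<dots> = (\<Sum>b\<in>Basis. inner h b * f' b)"
      by (simp add: linear_sum[OF lin] linear_cmul[OF lin])
    finally show "f' h = inner h (\<Sum>b\<in>Basis. f' b *\<^sub>R b)"
      by (simp add: inner_sum_right mult.commute)
  qed
  then have "GDERIV f x :> (\<Sum>b\<in>Basis. f' b *\<^sub>R b)"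
    using f' unfolding gderiv_def by simp
  then show ?thesis
    using gradient_eqI by metis
qed

definition L_smooth :: "real \<Rightarrow> ('a::euclidean_space \<Rightarrow> real) \<Rightarrow> bool" where
  "L_smooth L f \<longleftrightarrow> (\<forall>x. f differentiable (at x)) \<and> L-lipschitz_on UNIV (gradient f)"

definition silver_ratio :: real where
  "silver_ratio = 1 + sqrt 2"

definition silver_beta :: "nat \<Rightarrow> real" where
  "silver_beta k = 1 + silver_ratio powi (int k - 1)"

text \<open>The value at 0 is only a convention: the schedules are considered for positive indices.\<close>

fun silver_schedule :: "nat \<Rightarrow> real list" where
  "silver_schedule 0 = []"
| "silver_schedule (Suc 0) = [sqrt 2]"
| "silver_schedule (Suc (Suc k)) =
     silver_schedule (Suc k) @ [silver_beta (Suc k)] @ silver_schedule (Suc k)"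

definition balanced :: "real list \<Rightarrow> bool" where
  "balanced h \<longleftrightarrow>
     1 + 2 * (\<Sum>i<length h. h ! i) = (\<Prod>i<length h. (h ! i - 1) powi (-2))"

text \<open>\<open>join_step p h\<close> is the middle step $\alpha_k$ for $p = \pi^{(k)}$ and
  $h$ the right schedule of index $k$. Since \<open>0 powi (-2) = 0\<close>, the value $1$ itself is never a
  solution; see \<open>ex1_join_step\<close> for existence and uniqueness.\<close>

definition join_step :: "real list \<Rightarrow> real list \<Rightarrow> real" where
  "join_step p h = (THE a. a \<ge> 1 \<and> balanced (p @ [a] @ h))"

fun h_right :: "nat \<Rightarrow> real list" where
  "h_right 0 = []"
| "h_right (Suc 0) = [3 / 2]"
| "h_right (Suc (Suc k)) =
     silver_schedule (Suc k) @ [join_step (silver_schedule (Suc k)) (h_right (Suc k))]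
       @ h_right (Suc k)"

definition h_left :: "nat \<Rightarrow> real list" where
  "h_left k = rev (h_right k)"

definition rate :: "nat \<Rightarrow> real" where
  "rate k = 1 + 2 * (\<Sum>i<length (h_right k). h_right k ! i)"

lemma balanced_iff:
  "balanced h \<longleftrightarrow>
     1 + 2 * sum_list h = prod_list (map (\<lambda>s. 1 / (s - 1)\<^sup>2) h)"
proof -
  have "(\<Prod>i<length h. (h ! i - 1) powi (-2)) = prod_list (map (\<lambda>s. 1 / (s - 1)\<^sup>2) h)"
    by (simp add: prod.list_conv_set_nth atLeast0LessThan power_int_minus divide_inverse)
  then show ?thesis
    by (simp add: balanced_def sum_list_sum_nth atLeast0LessThan)
qed

lemma ex1_balance:
  fixes C D :: real
  assumes C: "C \<ge> 0" and D: "D > 0"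
  shows "\<exists>!a. a \<ge> 1 \<and> C + 2 * a = D * (1 / (a - 1)\<^sup>2)"
proof -
  define g where "g = (\<lambda>a::real. (C + 2 * a) * (a - 1)\<^sup>2)"
  have eq: "C + 2 * a = D * (1 / (a - 1)\<^sup>2) \<longleftrightarrow> g a = D" if "a \<ge> 1" for a
    using that C D by (cases "a = 1") (auto simp: g_def field_simps)
  have mono: "g a < g b" if "1 \<le> a" "a < b" for a b
  proof -
    have "(a - 1)\<^sup>2 < (b - 1)\<^sup>2"
      using that by (intro power_strict_mono) auto
    then show ?thesis
      unfolding g_def using that C by (intro mult_strict_mono) auto
  qed
  have "D \<le> g (2 + D)"
  proof -
    have "D * 1 \<le> (C + 2 * (2 + D)) * (2 + D - 1)\<^sup>2"
      using C D by (intro mult_mono one_le_power) auto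
    then show ?thesis by (simp add: g_def)
  qed
  moreover have "g 1 \<le> D"
    using D by (simp add: g_def)
  moreover have "continuous_on {1..2 + D} g"
    unfolding g_def by (intro continuous_intros)
  ultimately obtain a where "a \<ge> 1" "g a = D"
    using IVT'[of g 1 D "2 + D"] D by auto
  moreover have "b = a" if "b \<ge> 1" "g b = D" for b
    using mono[of a b] mono[of b a] that \<open>a \<ge> 1\<close> \<open>g a = D\<close> by (cases a b rule: linorder_cases) auto
  ultimately show ?thesis
    using eq by blast
qed

lemma ex1_join_step_aux:
  assumes "\<And>s. s \<in> set p \<Longrightarrow> s > 1" and "\<And>s. s \<in> set h \<Longrightarrow> s > 1"
  shows "\<exists>!a. a \<ge> 1 \<and> balanced (p @ [a] @ h)"
proof -
  define P where "P = (\<lambda>xs. prod_list (map (\<lambda>s::real. 1 / (s - 1)\<^sup>2) xs))"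
  have pos: "P xs > 0 \<and> sum_list xs \<ge> 0" if "\<And>s. s \<in> set xs \<Longrightarrow> s > 1" for xs :: "real list"
    using that unfolding P_def by (induction xs) force+
  have "balanced (p @ [a] @ h) \<longleftrightarrow>
      (1 + 2 * sum_list p + 2 * sum_list h) + 2 * a = (P p * P h) * (1 / (a - 1)\<^sup>2)" for a
    unfolding balanced_iff P_def by (simp add: algebra_simps)
  then show ?thesis
    using ex1_balance[of "1 + 2 * sum_list p + 2 * sum_list h" "P p * P h"]
      pos[OF assms(1)] pos[OF assms(2)] by simp
qed

lemma silver_schedule_gt_1: "s \<in> set (silver_schedule k) \<Longrightarrow> s > 1"
proof (induction k rule: silver_schedule.induct)
  case (3 k)
  have "silver_ratio > 0"
    by (simp add: silver_ratio_def add_pos_nonneg)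
  then have "silver_beta (Suc k) > 1"
    by (simp add: silver_beta_def)
  with 3 show ?case by auto
qed auto

lemma h_right_gt_1: "s \<in> set (h_right k) \<Longrightarrow> s > 1"
  and ex1_join_step: "\<exists>!a. a \<ge> 1 \<and> balanced (silver_schedule k @ [a] @ h_right k)"
proof -
  have ex1: "\<exists>!a. a \<ge> 1 \<and> balanced (silver_schedule k @ [a] @ h_right k)"
    if "\<And>s. s \<in> set (h_right k) \<Longrightarrow> s > 1" for k
    using ex1_join_step_aux silver_schedule_gt_1 that by blast
  have gt: "s > 1" if "s \<in> set (h_right k)" for s k
    using that
  proof (induction k arbitrary: s rule: h_right.induct)
    case (3 k)
    let ?p = "silver_schedule (Suc k)" and ?h = "h_right (Suc k)"
    define a where "a = join_step ?p ?h"
    have a: "a \<ge> 1" "balanced (?p @ [a] @ ?h)"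
      using theI'[OF ex1[of "Suc k"]] 3 unfolding a_def join_step_def by auto
    have "a \<noteq> 1"
    proof
      assume "a = 1"
      then have "1 + 2 * (sum_list ?p + 1 + sum_list ?h) = 0"
        using a(2) unfolding balanced_iff by simp
      moreover have "sum_list ?p \<ge> 0"
        using silver_schedule_gt_1 by (intro sum_list_nonneg) fastforce
      moreover have "sum_list ?h \<ge> 0"
        using 3 by (intro sum_list_nonneg) fastforce
      ultimately show False by simp
    qed
    then show ?case
      using 3 a(1) silver_schedule_gt_1[of _ "Suc k"] by (auto simp flip: a_def)
  qed auto
  show "s \<in> set (h_right k) \<Longrightarrow> s > 1"
    by (rule gt)
  show "\<exists>!a. a \<ge> 1 \<and> balanced (silver_schedule k @ [a] @ h_right k)"
    by (rule ex1) (rule gt)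
qed

lemma balanced_h_right: "balanced (h_right k)"
proof (cases k rule: h_right.cases)
  case (3 j)
  then show ?thesis
    using theI'[OF ex1_join_step[of "Suc j"]] by (simp add: join_step_def)
qed (simp_all add: balanced_iff power2_eq_square)

lemma rate_eq_prod:
  "rate k = (\<Prod>i<length (h_right k). (h_right k ! i - 1) powi (-2))"
  using balanced_h_right[of k] by (simp add: rate_def balanced_def)

lemma length_silver_schedule: "length (silver_schedule k) = 2 ^ k - 1"
  by (induction k rule: silver_schedule.induct) auto

lemma length_h_right: "length (h_right k) = 2 ^ k - 1"
  by (induction k rule: h_right.induct) (auto simp: length_silver_schedule)

end

theory Submission
  imports Defs
begin

text \<open>
  Rescale to \<open>F = f / L\<close> and \<open>g = \<nabla>f / L\<close>. Convexity and smoothness enter only through the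
  interpolation inequality \<open>F x - F y \<ge> \<langle>g y, x - y\<rangle> + \<parallel>g x - g y\<parallel>\<^sup>2 / 2\<close>; write \<open>Q(x, y)\<close> for it.

  Let \<open>v\<close> be the last iterate of the schedule \<open>h_left k\<close> started at \<open>x\<close>. The bound to prove by
  induction on \<open>k\<close> is \<open>F x - F v \<ge> (r - 1) / 2 * \<parallel>g v\<parallel>\<^sup>2\<close> with \<open>r = rate k\<close> (lemma
  \<open>h_left_decrease\<close>). It compares only the two ends of the run. The missing \<open>\<parallel>g v\<parallel>\<^sup>2 / 2\<close> is what one more
  step of length one from \<open>v\<close> would gain, and no point lies below the minimum.

  Since \<open>h_left (k + 1)\<close> appends a long step \<open>\<mu>\<close> and a silver schedule to \<open>h_left k\<close>, the induction
  needs to know what a silver schedule does after a long step. The relevant property of a schedule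
  of total length \<open>H\<close> leading from \<open>y\<close> to \<open>v\<close> is an energy inequality (\<open>composable\<close>): up to
  correction terms, \<open>\<parallel>v - z\<parallel>\<^sup>2 / 2 + H (F v - F z)\<close> is at most \<open>\<parallel>y - z\<parallel>\<^sup>2 / 2\<close>. It is
  essential that the reference point \<open>z\<close> is arbitrary and need not be a minimizer. If \<open>u\<close> is the
  point before the long step, so \<open>y = u - \<mu> g u\<close>, then the energy inequality is used for the two
  references \<open>z = u\<close> and \<open>z = v\<close>. In the sum the terms \<open>\<parallel>y - v\<parallel>\<^sup>2\<close> cancel, and adding \<open>Q(u, v)\<close>
  and \<open>\<mu> - 1\<close> times \<open>Q(v, u)\<close> cancels all inner products. What remains bounds \<open>F u - F v\<close> in terms
  of \<open>\<parallel>g u\<parallel>\<^sup>2\<close> and \<open>\<parallel>g v\<parallel>\<^sup>2\<close> (lemma \<open>decrease_step_composable\<close>).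

  This one estimate is used twice. With \<open>\<mu>\<close> a silver step it shows that the doubling
  \<open>h \<mapsto> [h, \<beta>, h]\<close> preserves the energy inequality (lemma \<open>composable_double\<close>), so all silver
  schedules satisfy it. With \<open>\<mu> = \<alpha>\<close>, the middle step of \<open>h_left (k + 1)\<close>, it is the induction step
  for the rate: the balancing equation that defines \<open>\<alpha>\<close> says precisely that the coefficient of
  \<open>\<parallel>g u\<parallel>\<^sup>2\<close> is the one supplied by the induction hypothesis and that of \<open>\<parallel>g v\<parallel>\<^sup>2\<close> the one claimed.

  For the asymptotics, put \<open>s = r / \<rho>\<^sup>k\<close> and \<open>t = (\<alpha> - 1) / \<rho>\<^sup>k\<close> with the silver ratio \<open>\<rho>\<close>. The
  balancing equation yields \<open>s = 2 t\<^sup>2 / (1 - t)\<close>, and \<open>2 / (\<rho> (1 - t))\<close> for the next value of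
  \<open>s\<close>. This recursion has the fixed point \<open>t = \<rho> powr (- 1 / 2)\<close> and contracts towards it.
\<close>

section \<open>Smooth convex interpolation\<close>

definition interpolating :: "('a::real_inner \<Rightarrow> real) \<Rightarrow> ('a \<Rightarrow> 'a) \<Rightarrow> bool" where
  "interpolating F g \<longleftrightarrow>
     (\<forall>x y. F y + g y \<bullet> (x - y) + (norm (g x - g y))\<^sup>2 / 2 \<le> F x)"

lemma interpolatingD:
  "interpolating F g \<Longrightarrow> F y + g y \<bullet> (x - y) + (norm (g x - g y))\<^sup>2 / 2 \<le> F x"
  by (simp add: interpolating_def)

lemma has_real_derivative_along_line:
  assumes "\<And>x. f differentiable (at x)"
  shows "((\<lambda>t. f (y + t *\<^sub>R d)) has_real_derivative gradient f (y + t *\<^sub>R d) \<bullet> d) (at t)"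
proof -
  have "(f has_derivative (\<lambda>h. h \<bullet> gradient f (y + t *\<^sub>R d))) (at (y + t *\<^sub>R d))"
    using GDERIV_gradient[OF assms] by (simp add: gderiv_def)
  moreover have "((\<lambda>t. y + t *\<^sub>R d) has_derivative (\<lambda>s. s *\<^sub>R d)) (at t)"
    by (auto intro!: derivative_eq_intros)
  ultimately have "((\<lambda>t. f (y + t *\<^sub>R d)) has_derivative
      (\<lambda>s. (s *\<^sub>R d) \<bullet> gradient f (y + t *\<^sub>R d))) (at t)"
    using has_derivative_compose by fastforce
  then show ?thesis
    by (simp add: has_field_derivative_def inner_commute mult_commute_abs)
qed

text \<open>Restriction to the line through the two points reduces this to one variable.\<close>

lemma convex_above_tangent:
  assumes "convex_on UNIV f" and "\<And>x. f differentiable (at x)"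
  shows "f y + gradient f y \<bullet> (x - y) \<le> f x"
proof -
  define \<phi> where "\<phi> = (\<lambda>t. f (y + t *\<^sub>R (x - y)))"
  have "convex_on UNIV \<phi>"
  proof (rule convex_onI)
    fix t a b :: real assume t: "0 < t" "t < 1"
    have "y + ((1 - t) *\<^sub>R a + t *\<^sub>R b) *\<^sub>R (x - y)
        = (1 - t) *\<^sub>R (y + a *\<^sub>R (x - y)) + t *\<^sub>R (y + b *\<^sub>R (x - y))"
      by (simp add: algebra_simps)
    then show "\<phi> ((1 - t) *\<^sub>R a + t *\<^sub>R b) \<le> (1 - t) * \<phi> a + t * \<phi> b"
      unfolding \<phi>_def using convex_onD[OF assms(1), of t "y + a *\<^sub>R (x - y)" "y + b *\<^sub>R (x - y)"] t
      by simp
  qed simp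
  moreover have "(\<phi> has_real_derivative gradient f y \<bullet> (x - y)) (at 0)"
    unfolding \<phi>_def using has_real_derivative_along_line[OF assms(2), where t = 0] by simp
  ultimately have "\<phi> 1 - \<phi> 0 \<ge> (gradient f y \<bullet> (x - y)) * (1 - 0)"
    by (intro convex_on_imp_above_tangent[where A = UNIV]) auto
  then show ?thesis
    by (simp add: \<phi>_def)
qed

text \<open>By the Lipschitz bound, the difference of the two sides is monotone along the segment from
  \<open>y\<close> to \<open>y + d\<close>.\<close>

lemma L_smooth_descent:
  assumes "L_smooth L f"
  shows "f (y + d) \<le> f y + gradient f y \<bullet> d + L / 2 * (norm d)\<^sup>2"
proof -
  have diff: "\<And>x. f differentiable (at x)" and lip: "L-lipschitz_on UNIV (gradient f)"
    using assms by (auto simp: L_smooth_def)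
  define \<psi> where "\<psi> = (\<lambda>t. f (y + t *\<^sub>R d) - t * (gradient f y \<bullet> d) - L / 2 * t\<^sup>2 * (norm d)\<^sup>2)"
  have der: "(\<psi> has_real_derivative
      gradient f (y + t *\<^sub>R d) \<bullet> d - gradient f y \<bullet> d - L * t * (norm d)\<^sup>2) (at t)" for t
    unfolding \<psi>_def
    by (auto intro!: derivative_eq_intros has_real_derivative_along_line[OF diff])
  have "gradient f (y + t *\<^sub>R d) \<bullet> d - gradient f y \<bullet> d - L * t * (norm d)\<^sup>2 \<le> 0" if "t \<ge> 0" for t
  proof -
    have "(gradient f (y + t *\<^sub>R d) - gradient f y) \<bullet> d
        \<le> norm (gradient f (y + t *\<^sub>R d) - gradient f y) * norm d"
      by (rule norm_cauchy_schwarz)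
    also have "\<dots> \<le> (L * norm (t *\<^sub>R d)) * norm d"
      using lipschitz_onD[OF lip, of "y + t *\<^sub>R d" y]
      by (intro mult_right_mono) (auto simp: dist_norm)
    finally show ?thesis
      using that by (simp add: inner_diff_left power2_eq_square mult.assoc)
  qed
  then have "\<exists>y. (\<psi> has_real_derivative y) (at t) \<and> y \<le> 0" if "0 \<le> t" for t
    using der that by blast
  then have "\<psi> 1 \<le> \<psi> 0"
    by (rule DERIV_nonpos_imp_nonincreasing[rotated]) simp_all
  then show ?thesis
    by (simp add: \<psi>_def)
qed

text \<open>The tangent at \<open>y\<close> is a lower bound and the quadratic model at \<open>x\<close> an upper bound for \<open>f\<close>.
  Comparing the two at the point \<open>z\<close> that minimizes the gap between them gives the inequality.\<close>

lemma interpolating_if_convex_L_smooth: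
  assumes "L > 0" and "convex_on UNIV f" and "L_smooth L f"
  shows "interpolating (\<lambda>x. f x / L) (\<lambda>x. gradient f x /\<^sub>R L)"
  unfolding interpolating_def
proof (intro allI)
  fix x y
  define e where "e = gradient f x - gradient f y"
  define z where "z = x + (- (1 / L)) *\<^sub>R e"
  have "f y + gradient f y \<bullet> (z - y) \<le> f z"
    using assms by (intro convex_above_tangent) (auto simp: L_smooth_def)
  also have "f z \<le> f x + gradient f x \<bullet> ((- (1 / L)) *\<^sub>R e) + L / 2 * (norm ((- (1 / L)) *\<^sub>R e))\<^sup>2"
    unfolding z_def by (rule L_smooth_descent[OF assms(3)])
  finally have "f y + gradient f y \<bullet> (z - y)
      \<le> f x - gradient f x \<bullet> e / L + (norm e)\<^sup>2 / (2 * L)"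
    using assms(1) by (simp add: power_mult_distrib power2_eq_square field_simps)
  moreover have "gradient f y \<bullet> (z - y) = gradient f y \<bullet> (x - y) - gradient f y \<bullet> e / L"
    by (simp add: z_def inner_diff_right inner_add_right)
  moreover have "gradient f x \<bullet> e / L = gradient f y \<bullet> e / L + 2 * ((norm e)\<^sup>2 / (2 * L))"
    by (simp add: e_def power2_norm_eq_inner inner_diff_left diff_divide_distrib)
  ultimately have "f y + gradient f y \<bullet> (x - y) + (norm e)\<^sup>2 / (2 * L) \<le> f x"
    by linarith
  then have "(f y + gradient f y \<bullet> (x - y) + (norm e)\<^sup>2 / (2 * L)) / L \<le> f x / L"
    using assms(1) by (intro divide_right_mono) auto
  moreover have "gradient f x /\<^sub>R L - gradient f y /\<^sub>R L = e /\<^sub>R L"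
    by (simp add: e_def scaleR_diff_right)
  moreover have "(norm (e /\<^sub>R L))\<^sup>2 / 2 = (norm e)\<^sup>2 / (2 * L) / L"
    using assms(1) by (simp add: power_mult_distrib power2_eq_square field_simps)
  ultimately show "f y / L + (gradient f y /\<^sub>R L) \<bullet> (x - y)
      + (norm (gradient f x /\<^sub>R L - gradient f y /\<^sub>R L))\<^sup>2 / 2 \<le> f x / L"
    by (simp only: distrib_left inner_scaleR_left divide_inverse_commute)
qed

section \<open>Energy inequalities for stepsize schedules\<close>

definition gd :: "('a::real_vector \<Rightarrow> 'a) \<Rightarrow> real list \<Rightarrow> 'a \<Rightarrow> 'a" where
  "gd g hs x = fold (\<lambda>s y. y - s *\<^sub>R g y) hs x"

lemma gd_Nil [simp]: "gd g [] x = x"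
  and gd_Cons [simp]: "gd g (s # hs) x = gd g hs (x - s *\<^sub>R g x)"
  and gd_append [simp]: "gd g (hs @ hs') x = gd g hs' (gd g hs x)"
  by (simp_all add: gd_def)

lemma gd_eq_iterate:
  assumes "\<forall>i<length hs. x (Suc i) = x i - (hs ! i) *\<^sub>R g (x i)"
  shows "x (length hs) = gd g hs (x 0)"
  using assms
proof (induction hs rule: rev_induct)
  case (snoc s hs)
  then have "x (length hs) = gd g hs (x 0)"
    by (auto simp: nth_append)
  then show ?case
    using snoc.prems by (auto dest: spec[of _ "length hs"])
qed simp

text \<open>
  For \<open>g z = 0\<close> this says that the energy \<open>\<parallel>v - z\<parallel>\<^sup>2 / 2 + H (F v - F z) + H (H + 1) / 2 * \<parallel>g v\<parallel>\<^sup>2\<close> at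
  the last iterate is at most \<open>\<parallel>x - z\<parallel>\<^sup>2 / 2\<close>. The last two terms on the right are what the
  interpolation inequalities \<open>Q(z, x\<^sub>i)\<close>, weighted by the steps \<open>h\<^sub>i\<close> of total length \<open>H\<close>, contribute
  in addition if \<open>g z\<close> does not vanish. Equality holds if \<open>F\<close> is a Huber function with minimizer
  \<open>z\<close> and all iterates stay in its linear part.
\<close>

definition energy_inequality ::
    "('a::real_inner \<Rightarrow> real) \<Rightarrow> ('a \<Rightarrow> 'a) \<Rightarrow> real \<Rightarrow> 'a \<Rightarrow> 'a \<Rightarrow> 'a \<Rightarrow> bool" where
  "energy_inequality F g H x v z \<longleftrightarrow>
     H * (F v - F z) + (norm (v - z))\<^sup>2 / 2 + H * (H + 1) / 2 * (norm (g v))\<^sup>2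
     \<le> (norm (x - z))\<^sup>2 / 2 + g z \<bullet> (x - v) - H / 2 * (norm (g z))\<^sup>2"

definition composable :: "('a::real_inner \<Rightarrow> real) \<Rightarrow> ('a \<Rightarrow> 'a) \<Rightarrow> real list \<Rightarrow> bool" where
  "composable F g hs \<longleftrightarrow> (\<forall>x z. energy_inequality F g (sum_list hs) x (gd g hs x) z)"

lemma composableD:
  assumes "composable F g hs"
  shows "sum_list hs * (F (gd g hs x) - F z) + (norm (gd g hs x - z))\<^sup>2 / 2
      + sum_list hs * (sum_list hs + 1) / 2 * (norm (g (gd g hs x)))\<^sup>2
    \<le> (norm (x - z))\<^sup>2 / 2 + g z \<bullet> (x - gd g hs x) - sum_list hs / 2 * (norm (g z))\<^sup>2"
  using assms by (simp only: composable_def energy_inequality_def)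

text \<open>
  Four inequalities are added: the energy inequality with reference \<open>u\<close>, the same with reference
  \<open>v\<close> (which says that \<open>\<parallel>y - v + g v\<parallel> \<ge> (H + 1) \<parallel>g v\<parallel>\<close> and so turns the square \<open>\<parallel>v - u\<parallel>\<^sup>2\<close> of the
  first into a multiple of \<open>\<parallel>g v\<parallel>\<^sup>2\<close>), \<open>Q(u, v)\<close>, and \<open>Q(v, u)\<close> with weight \<open>\<mu> - 1\<close>. The weight is determined by the product
  \<open>\<langle>g u, g v\<rangle>\<close>, whose coefficients \<open>1 - \<mu>\<close> from \<open>Q(u, v)\<close> and \<open>1\<close> from \<open>Q(v, u)\<close> must cancel. It
  also removes \<open>\<langle>g u, y - v\<rangle>\<close>.
\<close>

lemma decrease_step_composable:
  assumes F: "interpolating F g" and hs: "composable F g hs" and "\<mu> \<ge> 1"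
    and v: "v = gd g hs (u - \<mu> *\<^sub>R g u)" and H: "H = sum_list hs"
  shows "((H + 1) * (2 * H + 1) + \<mu> - 1) / 2 * (norm (g v))\<^sup>2
    \<le> (H + 2 - \<mu>) * (F u - F v) + ((\<mu> - 1) * (2 * \<mu> - 1) - (H + 1)) / 2 * (norm (g u))\<^sup>2"
proof -
  define y where "y = u - \<mu> *\<^sub>R g u"
  define d where "d = y - v"
  have u: "u = v + d + \<mu> *\<^sub>R g u"
    by (simp add: d_def y_def)
  define a b where "a = g u" and "b = g v"
  note S = composableD[OF hs, of y, folded H, folded v[folded y_def]]
  have Su: "H * (F v - F u) + (norm (d + \<mu> *\<^sub>R a))\<^sup>2 / 2 + H * (H + 1) / 2 * (norm b)\<^sup>2
      \<le> (norm (\<mu> *\<^sub>R a))\<^sup>2 / 2 + a \<bullet> d - H / 2 * (norm a)\<^sup>2"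
  proof -
    have "v - u = - (d + \<mu> *\<^sub>R a)" "y - u = - (\<mu> *\<^sub>R a)"
      by (simp_all add: d_def y_def a_def)
    then show ?thesis
      using S[of u] by (simp only: norm_minus_cancel a_def b_def d_def)
  qed
  have Sv: "H * (H + 1) / 2 * (norm b)\<^sup>2 \<le> (norm d)\<^sup>2 / 2 + b \<bullet> d - H / 2 * (norm b)\<^sup>2"
    using S[of v] by (simp add: a_def b_def d_def)
  have Quv: "F v + b \<bullet> (d + \<mu> *\<^sub>R a) + (norm (a - b))\<^sup>2 / 2 \<le> F u"
    using interpolatingD[OF F, of v u] u by (simp add: a_def b_def d_def y_def)
  have Qvu: "F u + a \<bullet> (- (d + \<mu> *\<^sub>R a)) + (norm (a - b))\<^sup>2 / 2 \<le> F v"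
  proof -
    have "v - u = - (d + \<mu> *\<^sub>R a)"
      by (simp_all add: d_def y_def a_def)
    then show ?thesis
      using interpolatingD[OF F, of u v] by (simp only: a_def b_def norm_minus_commute)
  qed
  \<comment> \<open>The slack of the claim is a nonnegative combination of the slacks of these inequalities.\<close>
  define slack_Su where "slack_Su = (norm (\<mu> *\<^sub>R a))\<^sup>2 / 2 + a \<bullet> d - H / 2 * (norm a)\<^sup>2
    - (H * (F v - F u) + (norm (d + \<mu> *\<^sub>R a))\<^sup>2 / 2 + H * (H + 1) / 2 * (norm b)\<^sup>2)"
  define slack_Sv where "slack_Sv = (norm d)\<^sup>2 / 2 + b \<bullet> d - H / 2 * (norm b)\<^sup>2
    - H * (H + 1) / 2 * (norm b)\<^sup>2"
  define slack_Quv where "slack_Quv = F u - (F v + b \<bullet> (d + \<mu> *\<^sub>R a) + (norm (a - b))\<^sup>2 / 2)"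
  define slack_Qvu where "slack_Qvu = F v - (F u + a \<bullet> (- (d + \<mu> *\<^sub>R a)) + (norm (a - b))\<^sup>2 / 2)"
  have "(H + 2 - \<mu>) * (F u - F v) + ((\<mu> - 1) * (2 * \<mu> - 1) - (H + 1)) / 2 * (norm a)\<^sup>2
      - ((H + 1) * (2 * H + 1) + \<mu> - 1) / 2 * (norm b)\<^sup>2
    = slack_Su + slack_Sv + slack_Quv + (\<mu> - 1) * slack_Qvu"
    unfolding slack_Su_def slack_Sv_def slack_Quv_def slack_Qvu_def power2_norm_eq_inner
      inner_add_left inner_add_right inner_diff_left inner_diff_right inner_minus_right
      inner_scaleR_left inner_scaleR_right
      inner_commute[of b a] inner_commute[of d a] inner_commute[of d b]
    by (simp add: algebra_simps add_divide_distrib diff_divide_distrib)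
  moreover have "slack_Su \<ge> 0" "slack_Sv \<ge> 0" "slack_Quv \<ge> 0" "(\<mu> - 1) * slack_Qvu \<ge> 0"
    using Su Sv Quv Qvu \<open>\<mu> \<ge> 1\<close>
    unfolding slack_Su_def slack_Sv_def slack_Quv_def slack_Qvu_def by auto
  ultimately show ?thesis
    unfolding a_def[symmetric] b_def[symmetric] by linarith
qed

lemma composable_Nil: "composable F g []"
  by (simp add: composable_def energy_inequality_def)

lemma silver_ratio_gt_1: "silver_ratio > 1"
  by (simp add: silver_ratio_def)

lemma silver_ratio_square: "silver_ratio\<^sup>2 = 2 * silver_ratio + 1"
  by (simp add: silver_ratio_def power2_eq_square algebra_simps)

text \<open>
  The energy inequalities of both halves and \<open>Q(z, u)\<close>, weighted by the middle step, add up to the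
  energy inequality of the doubled schedule except for terms in \<open>F u\<close>, \<open>F v\<close>, \<open>\<parallel>g u\<parallel>\<^sup>2\<close> and
  \<open>\<parallel>g v\<parallel>\<^sup>2\<close>. These terms are an estimate for \<open>F u - F v\<close>, where a step \<open>1 + m\<close> and the second half
  lead from \<open>u\<close> to \<open>v\<close>. It agrees with the one of the preceding lemma, up to the factor \<open>\<rho>\<close>, if
  \<open>H + 1 = \<rho> m\<close> with \<open>\<rho>\<^sup>2 = 2 \<rho> + 1\<close>: this is where the silver ratio comes from.
\<close>

lemma composable_double:
  assumes F: "interpolating F g" and hs: "composable F g hs"
    and "m > 0" and H: "sum_list hs + 1 = silver_ratio * m"
  shows "composable F g (hs @ [1 + m] @ hs)"
  unfolding composable_def
proof (intro allI)
  fix x z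
  define c where "c = silver_ratio * m"
  define u where "u = gd g hs x"
  define y where "y = u - (1 + m) *\<^sub>R g u"
  define v where "v = gd g hs y"
  have H': "sum_list hs = c - 1"
    using H by (simp add: c_def)
  have Sx: "(c - 1) * (F u - F z) + (norm (u - z))\<^sup>2 / 2 + (c - 1) * c / 2 * (norm (g u))\<^sup>2
      \<le> (norm (x - z))\<^sup>2 / 2 + g z \<bullet> (x - u) - (c - 1) / 2 * (norm (g z))\<^sup>2"
    using composableD[OF hs, of x z] by (simp add: H' u_def)
  have Sy: "(c - 1) * (F v - F z) + (norm (v - z))\<^sup>2 / 2 + (c - 1) * c / 2 * (norm (g v))\<^sup>2
      \<le> ((norm (u - z))\<^sup>2 - 2 * (1 + m) * (g u \<bullet> (u - z)) + (1 + m)\<^sup>2 * (norm (g u))\<^sup>2) / 2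
        + g z \<bullet> (y - v) - (c - 1) / 2 * (norm (g z))\<^sup>2"
  proof -
    have "y - z = (u - z) - (1 + m) *\<^sub>R g u"
      by (simp add: y_def)
    then have "(norm (y - z))\<^sup>2 = (norm ((u - z) - (1 + m) *\<^sub>R g u))\<^sup>2"
      by (simp only:)
    also have "\<dots> = (norm (u - z))\<^sup>2 - 2 * (1 + m) * (g u \<bullet> (u - z)) + (1 + m)\<^sup>2 * (norm (g u))\<^sup>2"
      unfolding power2_norm_eq_inner inner_diff_left[of "u - z"] inner_diff_right[of _ "u - z"]
        inner_scaleR_left inner_scaleR_right inner_commute[of "u - z" "g u"]
      by (simp add: algebra_simps power2_eq_square)
    finally show ?thesis
      using composableD[OF hs, of y z] by (simp add: H' v_def)
  qed
  have Q: "(1 + m) * (F u - g u \<bullet> (u - z)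
      + ((norm (g z))\<^sup>2 - 2 * (g z \<bullet> g u) + (norm (g u))\<^sup>2) / 2) \<le> (1 + m) * F z"
  proof -
    have "g u \<bullet> (z - u) = - (g u \<bullet> (u - z))"
      by (simp add: inner_diff_right)
    moreover have "(norm (g z - g u))\<^sup>2 = (norm (g z))\<^sup>2 - 2 * (g z \<bullet> g u) + (norm (g u))\<^sup>2"
      by (simp add: power2_norm_eq_inner inner_diff_left inner_diff_right inner_commute)
    ultimately show ?thesis
      using interpolatingD[OF F, of u z] \<open>m > 0\<close> by (intro mult_left_mono) auto
  qed
  \<comment> \<open>The estimate for \<open>F u - F v\<close>, scaled so that the coefficient of \<open>F u\<close> is the one left over.\<close>
  have J: "(c + m) * (3 * c + m - 1) / 2 * (norm (g v))\<^sup>2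
      \<le> (c + m) * (F u - F v) + (c + m) * (c - m - 1) / 2 * (norm (g u))\<^sup>2"
  proof -
    have "((c - 1 + 1) * (2 * (c - 1) + 1) + (1 + m) - 1) / 2 * (norm (g v))\<^sup>2
      \<le> (c - 1 + 2 - (1 + m)) * (F u - F v)
        + ((1 + m - 1) * (2 * (1 + m) - 1) - (c - 1 + 1)) / 2 * (norm (g u))\<^sup>2"
      using decrease_step_composable[OF F hs, of "1 + m" v u "c - 1"] \<open>m > 0\<close>
      by (simp add: H' v_def y_def)
    then have "(c * (2 * c - 1) + m) / 2 * (norm (g v))\<^sup>2
      \<le> (c - m) * (F u - F v) + (m * (2 * m + 1) - c) / 2 * (norm (g u))\<^sup>2"
      by (simp add: algebra_simps)
    then have "silver_ratio * ((c * (2 * c - 1) + m) / 2 * (norm (g v))\<^sup>2)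
      \<le> silver_ratio * ((c - m) * (F u - F v) + (m * (2 * m + 1) - c) / 2 * (norm (g u))\<^sup>2)"
      using silver_ratio_gt_1 by (intro mult_left_mono) auto
    moreover have "silver_ratio * (c - m) = c + m"
      and "silver_ratio * (c * (2 * c - 1) + m) = (c + m) * (3 * c + m - 1)"
      and "silver_ratio * (m * (2 * m + 1) - c) = (c + m) * (c - m - 1)"
      unfolding c_def using silver_ratio_square by algebra+
    ultimately show ?thesis
      by (simp add: distrib_left flip: mult.assoc)
  qed
  have xv: "g z \<bullet> (x - v) = g z \<bullet> (x - u) + g z \<bullet> (y - v) + (1 + m) * (g z \<bullet> g u)"
    by (simp add: y_def inner_diff_right)
  have "energy_inequality F g (2 * c + m - 1) x v z"
    using Sx Sy Q J unfolding energy_inequality_def xv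
    by (simp add: algebra_simps power2_eq_square add_divide_distrib diff_divide_distrib)
  moreover have "sum_list (hs @ [1 + m] @ hs) = 2 * c + m - 1"
    by (simp add: H')
  moreover have "gd g (hs @ [1 + m] @ hs) x = v"
    by (simp add: u_def y_def v_def)
  ultimately show "energy_inequality F g (sum_list (hs @ [1 + m] @ hs)) x
      (gd g (hs @ [1 + m] @ hs) x) z"
    by (simp only:)
qed

section \<open>Silver schedules\<close>

lemma silver_beta_eq: "silver_beta k = 1 + silver_ratio ^ k / silver_ratio"
  using silver_ratio_gt_1 by (simp add: silver_beta_def power_int_diff)

lemma silver_schedule_Suc:
  "silver_schedule (Suc k) = silver_schedule k @ [silver_beta k] @ silver_schedule k"
proof (cases k)
  case 0
  have "silver_ratio * (sqrt 2 - 1) = 1"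
    by (simp add: silver_ratio_def algebra_simps)
  then have "sqrt 2 = 1 + 1 / silver_ratio"
    using silver_ratio_gt_1 by (simp add: field_simps)
  then show ?thesis
    using 0 by (simp add: silver_beta_eq)
qed simp

lemma sum_list_silver_schedule: "sum_list (silver_schedule k) = silver_ratio ^ k - 1"
proof (induction k)
  case (Suc k)
  have "silver_ratio = 2 + 1 / silver_ratio"
    using silver_ratio_square silver_ratio_gt_1 by (simp add: field_simps power2_eq_square)
  then have "silver_ratio ^ Suc k = (2 + 1 / silver_ratio) * silver_ratio ^ k"
    by simp
  also have "\<dots> = 2 * silver_ratio ^ k + silver_ratio ^ k / silver_ratio"
    by (simp add: distrib_right)
  finally show ?case
    using Suc by (simp add: silver_schedule_Suc silver_beta_eq)
qed simp

lemma rev_silver_schedule: "rev (silver_schedule k) = silver_schedule k"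
  by (induction k) (auto simp: silver_schedule_Suc simp del: silver_schedule.simps(3))

lemma prod_list_silver_schedule:
  "prod_list (map (\<lambda>s. 1 / (s - 1)\<^sup>2) (silver_schedule k)) = (silver_ratio ^ k)\<^sup>2"
proof (induction k)
  case (Suc k)
  then show ?case
    using silver_ratio_gt_1
    by (simp add: silver_schedule_Suc silver_beta_eq power2_eq_square field_simps)
qed simp

lemma composable_silver_schedule:
  assumes "interpolating F g"
  shows "composable F g (silver_schedule k)"
proof (induction k)
  case 0
  show ?case by (simp add: composable_Nil)
next
  case (Suc k)
  have "silver_ratio ^ k / silver_ratio > 0"
    using silver_ratio_gt_1 by simp
  moreover have "sum_list (silver_schedule k) + 1 = silver_ratio * (silver_ratio ^ k / silver_ratio)"
    using silver_ratio_gt_1 by (simp add: sum_list_silver_schedule)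
  ultimately show ?case
    unfolding silver_schedule_Suc silver_beta_eq by (rule composable_double[OF assms Suc])
qed

section \<open>The balanced schedules\<close>

text \<open>This is \<open>\<alpha>\<^sub>k\<close>. At index 0 the balancing equation has the solution \<open>3 / 2\<close>, the single entry of
  the first schedule, so that the recursion can start from the empty schedule.\<close>

definition middle_step :: "nat \<Rightarrow> real" where
  "middle_step k = join_step (silver_schedule k) (h_right k)"

lemma h_right_Suc: "h_right (Suc k) = silver_schedule k @ [middle_step k] @ h_right k"
proof (cases k)
  case 0
  have "middle_step 0 = 3 / 2"
    unfolding middle_step_def join_step_def
    using ex1_join_step[of 0] balanced_h_right[of 1] by (intro the1_equality) auto
  then show ?thesis
    using 0 by simp
qed (simp add: middle_step_def)

lemma h_left_Suc: "h_left (Suc k) = h_left k @ [middle_step k] @ silver_schedule k"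
  by (simp add: h_left_def h_right_Suc rev_silver_schedule del: h_right.simps)

lemma rate_eq_sum_list: "rate k = 1 + 2 * sum_list (h_right k)"
  by (simp add: rate_def sum_list_sum_nth atLeast0LessThan)

lemma rate_eq_prod_list: "rate k = prod_list (map (\<lambda>s. 1 / (s - 1)\<^sup>2) (h_right k))"
  using balanced_h_right[of k] by (simp add: balanced_iff rate_eq_sum_list)

lemma rate_ge_1: "rate k \<ge> 1"
proof -
  have "sum_list (h_right k) \<ge> 0"
    using h_right_gt_1 by (intro sum_list_nonneg) force
  then show ?thesis
    by (simp add: rate_eq_sum_list)
qed

text \<open>
  Write \<open>r\<close> and \<open>r'\<close> for two consecutive rates. As sums they satisfy \<open>r' = r + 2 (m + c)\<close>, as
  products \<open>r c\<^sup>2 = m\<^sup>2 r'\<close>. Eliminating \<open>r'\<close> gives an equation divisible by \<open>c + m\<close>, and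
  cancelling this factor leaves the two relations below.
\<close>

lemma rate_middle_step:
  defines "m \<equiv> \<lambda>k. middle_step k - 1" and "c \<equiv> \<lambda>k. silver_ratio ^ k"
  shows "0 < m k" "m k < c k"
    and "rate k * (c k - m k) = 2 * (m k)\<^sup>2"
    and "rate (Suc k) * (c k - m k) = 2 * (c k)\<^sup>2"
proof -
  show m: "0 < m k"
    using h_right_gt_1[of "middle_step k" "Suc k"] by (simp add: h_right_Suc m_def del: h_right.simps)
  have c: "0 < c k"
    using silver_ratio_gt_1 by (simp add: c_def)
  have sum: "rate (Suc k) = rate k + 2 * (m k + c k)"
    by (simp add: rate_eq_sum_list h_right_Suc sum_list_silver_schedule m_def c_def
        del: h_right.simps)
  have prod: "rate k * (c k)\<^sup>2 = (m k)\<^sup>2 * rate (Suc k)"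
    using m rate_eq_prod_list[of k]
    by (simp add: rate_eq_prod_list[of "Suc k"] h_right_Suc prod_list_silver_schedule m_def c_def
        del: h_right.simps)
  have "(rate k * (c k - m k) - 2 * (m k)\<^sup>2) * (c k + m k) = 0"
    using prod unfolding sum by algebra
  then show r: "rate k * (c k - m k) = 2 * (m k)\<^sup>2"
    using m c by simp
  then have "0 < rate k * (c k - m k)"
    using m by simp
  then show "m k < c k"
    using rate_ge_1[of k] by (simp add: zero_less_mult_iff)
  show "rate (Suc k) * (c k - m k) = 2 * (c k)\<^sup>2"
    using r unfolding sum by algebra
qed

text \<open>
  In the induction step, the relations of the preceding lemma turn both coefficients of
  \<open>decrease_step_composable\<close> into \<open>c - m\<close> times those of the claim for \<open>k\<close> and \<open>k + 1\<close>.
\<close>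

lemma h_left_decrease:
  assumes F: "interpolating F g"
  shows "(rate k - 1) / 2 * (norm (g (gd g (h_left k) x)))\<^sup>2 \<le> F x - F (gd g (h_left k) x)"
proof (induction k)
  case 0
  show ?case
    by (simp add: h_left_def rate_def)
next
  case (Suc k)
  define m where "m = middle_step k - 1"
  define c where "c = silver_ratio ^ k"
  define u where "u = gd g (h_left k) x"
  define v where "v = gd g (silver_schedule k) (u - (1 + m) *\<^sub>R g u)"
  define a b where "a = (norm (g u))\<^sup>2" and "b = (norm (g v))\<^sup>2"
  note r = rate_middle_step[of k, folded m_def c_def]
  have v: "gd g (h_left (Suc k)) x = v"
    by (simp add: h_left_Suc u_def v_def m_def)
  have H: "c - 1 = sum_list (silver_schedule k)"
    by (simp add: sum_list_silver_schedule c_def)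
  have "((c - 1 + 1) * (2 * (c - 1) + 1) + (1 + m) - 1) / 2 * b
    \<le> (c - 1 + 2 - (1 + m)) * (F u - F v)
      + ((1 + m - 1) * (2 * (1 + m) - 1) - (c - 1 + 1)) / 2 * a"
    unfolding a_def b_def using r(1)
    by (intro decrease_step_composable[OF F composable_silver_schedule[OF F]]) (auto simp: v_def H)
  moreover have "(c - 1 + 1) * (2 * (c - 1) + 1) + (1 + m) - 1 = (c - m) * (rate (Suc k) - 1)"
    using r(4) by algebra
  moreover have "(1 + m - 1) * (2 * (1 + m) - 1) - (c - 1 + 1) = (c - m) * (rate k - 1)"
    using r(3) by algebra
  moreover have "c - 1 + 2 - (1 + m) = c - m"
    by simp
  ultimately have "(c - m) * (rate (Suc k) - 1) / 2 * b
      \<le> (c - m) * (F u - F v) + (c - m) * (rate k - 1) / 2 * a"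
    by (simp only:)
  then have "(c - m) * ((rate (Suc k) - 1) / 2 * b)
      \<le> (c - m) * (F u - F v + (rate k - 1) / 2 * a)"
    by (simp add: distrib_left mult.assoc)
  then have "(rate (Suc k) - 1) / 2 * b \<le> F u - F v + (rate k - 1) / 2 * a"
    using r(2) by simp
  with Suc show ?case
    unfolding v by (simp add: a_def b_def u_def)
qed

text \<open>A unit step from \<open>v\<close> decreases \<open>F\<close> by at least \<open>\<parallel>g v\<parallel>\<^sup>2 / 2\<close>; this turns the
  factor \<open>(rate k - 1) / 2\<close> into \<open>rate k / 2\<close>.\<close>

lemma h_left_gradient_bound:
  assumes F: "interpolating F g" and min: "\<And>y. F x_star \<le> F y"
  shows "rate k / 2 * (norm (g (gd g (h_left k) x)))\<^sup>2 \<le> F x - F x_star"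
proof -
  define v where "v = gd g (h_left k) x"
  define w where "w = v - g v"
  have "F w + g w \<bullet> g v + (norm (g v - g w))\<^sup>2 / 2 \<le> F v"
    using interpolatingD[OF F, of w v] by (simp add: w_def)
  moreover have "(norm (g v - g w))\<^sup>2 = (norm (g v))\<^sup>2 - 2 * (g w \<bullet> g v) + (norm (g w))\<^sup>2"
    by (simp add: power2_norm_eq_inner inner_diff_left inner_diff_right inner_commute)
  moreover have "0 \<le> (norm (g w))\<^sup>2"
    by simp
  ultimately have "(norm (g v))\<^sup>2 / 2 \<le> F v - F w"
    by argo
  also have "\<dots> \<le> F v - F x_star"
    using min by simp
  finally show ?thesis
    using h_left_decrease[OF F, of k x] by (simp add: v_def algebra_simps diff_divide_distrib)
qed

section \<open>Asymptotics of the rate\<close>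

text \<open>
  With \<open>s\<close> and \<open>t\<close> as in the proof, \<open>s k\<close> and \<open>s (k + 1)\<close> are both explicit functions of \<open>t\<close>, and the
  limit \<open>l\<close> is their common value at \<open>t = b\<close>, where \<open>b\<^sup>2 = 1 / \<rho>\<close>. Comparing the deviations from
  \<open>l\<close> gives \<open>(s (k + 1) - l) * (b + t (1 - b)) = b\<^sup>2 * (s k - l)\<close>, a contraction by the factor \<open>b\<close>.
\<close>

lemma rate_over_power_tendsto:
  defines "b \<equiv> silver_ratio powr (- 1 / 2)"
  shows "(\<lambda>k. rate k / silver_ratio ^ k) \<longlonglongrightarrow> (silver_ratio - 1) * (1 + b)"
proof -
  define s where "s = (\<lambda>k. rate k / silver_ratio ^ k)"
  define l where "l = 2 * b\<^sup>2 / (1 - b)"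
  have b2: "b\<^sup>2 = 1 / silver_ratio"
    using silver_ratio_gt_1
    by (simp add: b_def power2_eq_square powr_minus_divide flip: powr_add)
  have "0 < b"
    using silver_ratio_gt_1 by (simp add: b_def)
  moreover have "b\<^sup>2 < 1\<^sup>2"
    using silver_ratio_gt_1 by (simp add: b2)
  then have "b < 1"
    by (rule power_less_imp_less_base) simp
  ultimately have b: "0 < b" "b < 1" .
  have contract: "\<bar>s (Suc k) - l\<bar> \<le> b * \<bar>s k - l\<bar>" for k
  proof -
    define c where "c = silver_ratio ^ k"
    define t where "t = (middle_step k - 1) / c"
    have c: "c > 0"
      using silver_ratio_gt_1 by (simp add: c_def)
    have t: "0 < t" "t < 1" and tc: "middle_step k - 1 = t * c"
      using rate_middle_step(1,2)[of k, folded c_def] c by (simp_all add: t_def)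
    have "rate k = s k * c" and "rate (Suc k) = silver_ratio * s (Suc k) * c"
      using c silver_ratio_gt_1 by (simp_all add: s_def c_def)
    then have "c\<^sup>2 * (s k * (1 - t)) = c\<^sup>2 * (2 * t\<^sup>2)"
      and "c\<^sup>2 * (silver_ratio * s (Suc k) * (1 - t)) = c\<^sup>2 * 2"
      using rate_middle_step(3,4)[of k, folded c_def, unfolded tc] by algebra+
    then have s: "s k * (1 - t) = 2 * t\<^sup>2" "silver_ratio * s (Suc k) * (1 - t) = 2"
      using c by simp_all
    have "silver_ratio * b\<^sup>2 = 1"
      using b2 silver_ratio_gt_1 by simp
    moreover have "l * (1 - b) = 2 * b\<^sup>2"
      using b by (simp add: l_def)
    ultimately have "((s (Suc k) - l) * (b + t * (1 - b)) - b\<^sup>2 * (s k - l)) * ((1 - t) * (1 - b)) = 0"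
      using s by algebra
    then have "(s (Suc k) - l) * (b + t * (1 - b)) = b\<^sup>2 * (s k - l)"
      using t b by simp
    then have "\<bar>s (Suc k) - l\<bar> * \<bar>b + t * (1 - b)\<bar> = b\<^sup>2 * \<bar>s k - l\<bar>"
      by (metis abs_mult abs_power2)
    moreover have "\<bar>b + t * (1 - b)\<bar> = b + t * (1 - b)"
      using t b by (intro abs_of_nonneg add_nonneg_nonneg mult_nonneg_nonneg) auto
    ultimately have "\<bar>s (Suc k) - l\<bar> * (b + t * (1 - b)) = b\<^sup>2 * \<bar>s k - l\<bar>"
      by simp
    moreover have "\<bar>s (Suc k) - l\<bar> * b \<le> \<bar>s (Suc k) - l\<bar> * (b + t * (1 - b))"
      using t b by (intro mult_left_mono) auto
    ultimately have "b * \<bar>s (Suc k) - l\<bar> \<le> b * (b * \<bar>s k - l\<bar>)"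
      by (simp add: power2_eq_square mult_ac)
    then show ?thesis
      using b by simp
  qed
  have "\<bar>s k - l\<bar> \<le> b ^ k * \<bar>s 0 - l\<bar>" for k
  proof (induction k)
    case (Suc k)
    then have "b * \<bar>s k - l\<bar> \<le> b * (b ^ k * \<bar>s 0 - l\<bar>)"
      using b by (intro mult_left_mono) auto
    with contract[of k] show ?case by simp
  qed simp
  moreover have "(\<lambda>k. b ^ k * \<bar>s 0 - l\<bar>) \<longlonglongrightarrow> 0"
    using b by (intro tendsto_mult_left_zero LIMSEQ_power_zero) simp
  ultimately have "(\<lambda>k. s k - l) \<longlonglongrightarrow> 0"
    by (intro Lim_null_comparison[of "\<lambda>k. s k - l" "\<lambda>k. b ^ k * \<bar>s 0 - l\<bar>"]) auto
  then have "s \<longlonglongrightarrow> l"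
    by (simp add: LIM_zero_iff)
  moreover have "l = (silver_ratio - 1) * (1 + b)"
  proof -
    have "silver_ratio * b\<^sup>2 = 1"
      using b2 silver_ratio_gt_1 by simp
    then have "2 * b\<^sup>2 = (silver_ratio - 1) * (1 + b) * (1 - b)"
      using silver_ratio_square by algebra
    then show ?thesis
      using b by (simp add: l_def)
  qed
  ultimately show ?thesis
    by (simp add: s_def)
qed

text \<open>Replacing \<open>2\<^sup>j\<close> by \<open>2\<^sup>j - 1\<close> changes the power by a factor that tends to 1.\<close>

lemma rate_asymptotics:
  "(\<lambda>j. rate j / real (2 ^ j - 1) powr log 2 silver_ratio)
    \<longlonglongrightarrow> (silver_ratio - 1) * (1 + silver_ratio powr (- 1 / 2))"
proof -
  define p where "p = log 2 silver_ratio"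
  have "real (2 ^ j - 1) powr p = silver_ratio ^ j * (1 - (1 / 2) ^ j) powr p" for j
  proof -
    have "real (2 ^ j - 1) = 2 ^ j * (1 - (1 / 2) ^ j)"
      by (simp add: of_nat_diff algebra_simps flip: power_mult_distrib)
    then have "real (2 ^ j - 1) powr p = (2 ^ j) powr p * (1 - (1 / 2) ^ j) powr p"
      by (simp add: powr_mult power_le_one)
    also have "(2 ^ j) powr p = (2 powr p) powr real j"
      by (simp add: powr_powr mult.commute flip: powr_realpow)
    also have "\<dots> = silver_ratio ^ j"
      using silver_ratio_gt_1 by (simp add: p_def powr_realpow)
    finally show ?thesis .
  qed
  then have eq: "rate j / real (2 ^ j - 1) powr p
      = rate j / silver_ratio ^ j / (1 - (1 / 2) ^ j) powr p" for j
    by simp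
  have "(\<lambda>j. (1 - (1 / 2 :: real) ^ j) powr p) \<longlonglongrightarrow> (1 - 0) powr p"
    by (intro tendsto_intros LIMSEQ_power_zero) auto
  then show ?thesis
    using tendsto_divide[OF rate_over_power_tendsto, of _ 1]
    unfolding eq p_def[symmetric] by simp
qed

theorem theorem1:
  fixes f :: "real ^ 'n \<Rightarrow> real"
    and L :: real
    and x_star :: "real ^ 'n"
    and x :: "nat \<Rightarrow> real ^ 'n"
    and k N :: nat
  assumes "L > 0"
    and "convex_on UNIV f"
    and "L_smooth L f"
    and "\<forall>y. f x_star \<le> f y"
    and "N = 2 ^ k - 1"
    and "\<forall>i<N. x (Suc i) = x i - (h_left k ! i / L) *\<^sub>R gradient f (x i)"
  shows "1 / 2 * (norm (gradient f (x N)))\<^sup>2 \<le> L * (f (x 0) - f x_star) / rate k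
    \<and> (\<lambda>j. rate j / real (2 ^ j - 1) powr log 2 silver_ratio)
        \<longlonglongrightarrow> (silver_ratio - 1) * (1 + silver_ratio powr (- 1 / 2))"
proof
  define g where "g = (\<lambda>y. gradient f y /\<^sub>R L)"
  have F: "interpolating (\<lambda>y. f y / L) g"
    unfolding g_def using assms(1-3) by (rule interpolating_if_convex_L_smooth)
  have N: "N = length (h_left k)"
    by (simp add: assms(5) h_left_def length_h_right)
  have "x N = gd g (h_left k) (x 0)"
    unfolding N using assms(6) by (intro gd_eq_iterate) (simp add: N g_def divide_inverse)
  then have "rate k / 2 * (norm (g (x N)))\<^sup>2 \<le> f (x 0) / L - f x_star / L"
    using h_left_gradient_bound[OF F, of x_star k "x 0"] assms(1,4)
    by (simp add: divide_right_mono)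
  moreover have "(norm (g (x N)))\<^sup>2 = (norm (gradient f (x N)))\<^sup>2 / L\<^sup>2"
    using assms(1) by (simp add: g_def power_mult_distrib divide_inverse mult.commute power_inverse)
  ultimately have "rate k / 2 * (norm (gradient f (x N)))\<^sup>2 / L\<^sup>2 \<le> (f (x 0) - f x_star) / L"
    by (simp add: diff_divide_distrib)
  then show "1 / 2 * (norm (gradient f (x N)))\<^sup>2 \<le> L * (f (x 0) - f x_star) / rate k"
    using assms(1) rate_ge_1[of k] by (simp add: field_simps power2_eq_square)
qed (rule rate_asymptotics)

end
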